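(* For every $\epsilon>0$ there is an online algorithm with advice for the simple unbounded knapsack problem that uses $O((1/\epsilon)\log(n/\epsilon))$ advice bits on instances with $n$ items and has competitive ratio at most $1+\epsilon$.
   Context: Online simple unbounded knapsack problem: knapsack capacity $1$; an instance is a sequence of items $x_1,\dots,x_n$ ($n$ unknown to the algorithm) with sizes $s_i\in[0,1]$ and values $v_i=s_i$. Items arrive one by one; upon arrival of $x_i$ the algorithm irrevocably chooses a number $k_i\in\mathbb{N}_0$ of copies to pack, with the total packed size never exceeding $1$. $\mathrm{opt}(I)=\max\{\sum_i k_i v_i: k_i\in\mathbb{N}_0,\sum_i k_i s_i\le1\}$; the (strict) competitive ratio on $I$ is $\mathrm{opt}(I)/\mathrm{gain}(I)$ where $\mathrm{gain}(I)$ is the total packed value, and the competitive ratio of an algorithm is its supremum over instances. Advice model (tape model): an oracle knowing the whole instance writes an infinite binary advice string, which the deterministic online algorithm may read from the beginning; the algorithm uses $f(n)$ advice bits if on every instance with $n$ items it reads at most the first $f(n)$ bits. *)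

theory Defs
  imports "HOL-Analysis.Analysis"
begin

section \<open>The simple unbounded knapsack problem\<close>

text \<open>An instance is the list of item sizes in order of arrival; the value of an item is its size.
  A packing is the list of the numbers of copies.\<close>

definition instances :: "real list set" where
  "instances = {I. set I \<subseteq> {0..1}}"

definition packed :: "real list \<Rightarrow> nat list \<Rightarrow> real" where
  "packed I ks = (\<Sum>i<length I. real (ks ! i) * I ! i)"

definition packings :: "real list \<Rightarrow> nat list set" where
  "packings I = {ks. length ks = length I \<and> packed I ks \<le> 1}"

definition opt :: "real list \<Rightarrow> real" where
  "opt I = Max (packed I ` packings I)"

text \<open>The maximum exists: items of size 0 admit arbitrarily many copies, but they do not
  contribute to the value.\<close>

lemma finite_packed_packings:
  assumes "I \<in> instances"
  shows "finite (packed I ` packings I)"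
proof -
  have nonneg: "I ! i \<ge> 0" if "i < length I" for i
    using assms nth_mem[OF that] by (force simp: instances_def subset_iff)
  define N where "N = Max (insert 0 ((\<lambda>s. nat \<lceil>1 / s\<rceil>) ` set I))"
  define L where "L = {ks. set ks \<subseteq> {..N} \<and> length ks = length I}"
  have "packed I ` packings I \<subseteq> packed I ` L"
  proof
    fix v assume "v \<in> packed I ` packings I"
    then obtain ks where ks: "length ks = length I" "packed I ks \<le> 1" "v = packed I ks"
      by (auto simp: packings_def)
    define ks' where "ks' = map (\<lambda>i. if I ! i = 0 then 0 else ks ! i) [0..<length I]"
    have "v = packed I ks'"
      unfolding ks(3) packed_def ks'_def by (intro sum.cong) auto
    moreover have "ks' ! i \<le> N" if i: "i < length I" for i
    proof (cases "I ! i = 0")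
      case True
      then show ?thesis using i by (simp add: ks'_def)
    next
      case False
      then have pos: "I ! i > 0" using nonneg[OF i] by simp
      have "real (ks ! i) * I ! i \<le> packed I ks"
        unfolding packed_def using i nonneg
        by (intro member_le_sum[where f = "\<lambda>i. real (ks ! i) * I ! i"]) auto
      then have "real (ks ! i) \<le> 1 / I ! i"
        using ks(2) pos by (simp add: field_simps)
      then have "ks ! i \<le> nat \<lceil>1 / I ! i\<rceil>"
        by linarith
      also have "\<dots> \<le> N"
        unfolding N_def using i by (intro Max_ge) auto
      finally show ?thesis using i by (simp add: ks'_def)
    qed
    moreover have "length ks' = length I"
      by (simp add: ks'_def)
    ultimately have "v = packed I ks'" "ks' \<in> L"
      unfolding L_def by (auto simp: in_set_conv_nth)
    then show "v \<in> packed I ` L" by blast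
  qed
  moreover have "finite L"
    using finite_lists_length_eq[of "{..N}" "length I"] by (simp add: L_def)
  ultimately show ?thesis by (meson finite_imageI finite_subset)
qed

lemma packings_nonempty: "replicate (length I) 0 \<in> packings I"
  by (simp add: packings_def packed_def)

section \<open>Online algorithms with advice\<close>

text \<open>A deterministic algorithm is applied to the items seen so far, including the current one, and
  to the advice bits read so far.  The result \<open>None\<close> means that it reads the next advice bit,
  \<open>Some k\<close> that it packs \<open>k\<close> copies of the current item.  The number of items is not an input.\<close>

type_synonym algorithm = "real list \<Rightarrow> bool list \<Rightarrow> nat option"

type_synonym advice = "nat \<Rightarrow> bool"

type_synonym oracle_fun = "real list \<Rightarrow> advice"

definition bits :: "advice \<Rightarrow> nat \<Rightarrow> bool list" where
  "bits \<phi> m = map \<phi> [0..<m]"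

text \<open>\<open>run A \<phi> I ks m\<close>: with advice \<open>\<phi>\<close>, the algorithm processes all items of \<open>I\<close>, packs \<open>ks\<close> and has
  then read exactly the first \<open>m\<close> advice bits.  There is no such \<open>ks\<close> and \<open>m\<close> if it reads forever.\<close>

inductive run :: "algorithm \<Rightarrow> advice \<Rightarrow> real list \<Rightarrow> nat list \<Rightarrow> nat \<Rightarrow> bool"
  for A :: algorithm and \<phi> :: advice where
  empty: "run A \<phi> [] [] 0"
| item: "\<lbrakk>run A \<phi> I ks m; m \<le> m';
    \<forall>j. m \<le> j \<and> j < m' \<longrightarrow> A (I @ [x]) (bits \<phi> j) = None;
    A (I @ [x]) (bits \<phi> m') = Some k\<rbrakk>
    \<Longrightarrow> run A \<phi> (I @ [x]) (ks @ [k]) m'"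

lemma run_length: "run A \<phi> I ks m \<Longrightarrow> length ks = length I"
  by (induction rule: run.induct) auto

lemma run_deterministic:
  "run A \<phi> I ks m \<Longrightarrow> run A \<phi> I ls n \<Longrightarrow> ks = ls \<and> m = n"
proof (induction arbitrary: ls n rule: run.induct)
  case empty
  then show ?case by (auto elim: run.cases)
next
  case (item I ks m m' x k)
  from item.prems obtain ls' l n' where l: "ls = ls' @ [l]" "run A \<phi> I ls' n'" "n' \<le> n"
    "\<forall>j. n' \<le> j \<and> j < n \<longrightarrow> A (I @ [x]) (bits \<phi> j) = None" "A (I @ [x]) (bits \<phi> n) = Some l"
    by (auto elim: run.cases)
  have eq: "ks = ls'" "m = n'" using item.IH[OF l(2)] by auto
  have "m' = n"
  proof (rule linorder_cases[of m' n])
    assume "m' < n"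
    then show ?thesis using l(4) item.hyps eq by auto
  next
    assume "n < m'"
    then show ?thesis using l(3,5) item.hyps eq by auto
  qed
  then show ?case using l(1,5) item.hyps eq by auto
qed

definition packing :: "algorithm \<Rightarrow> advice \<Rightarrow> real list \<Rightarrow> nat list" where
  "packing A \<phi> I = (THE ks. \<exists>m. run A \<phi> I ks m)"

definition bits_read :: "algorithm \<Rightarrow> advice \<Rightarrow> real list \<Rightarrow> nat" where
  "bits_read A \<phi> I = (THE m. \<exists>ks. run A \<phi> I ks m)"

lemma run_packing_bits_read:
  assumes "run A \<phi> I ks m"
  shows "packing A \<phi> I = ks" and "bits_read A \<phi> I = m"
  unfolding packing_def bits_read_def using assms run_deterministic[OF assms] by blast+

definition gain :: "algorithm \<Rightarrow> advice \<Rightarrow> real list \<Rightarrow> real" where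
  "gain A \<phi> I = packed I (packing A \<phi> I)"

text \<open>The knapsack must never overflow, whatever is written on the tape; only on the tape that the
  oracle provides must the algorithm reach a decision for every item.\<close>

definition online_algorithm_with_advice :: "algorithm \<Rightarrow> oracle_fun \<Rightarrow> bool" where
  "online_algorithm_with_advice A orc \<longleftrightarrow>
    (\<forall>I\<in>instances. \<forall>\<phi> ks m. run A \<phi> I ks m \<longrightarrow> packed I ks \<le> 1) \<and>
    (\<forall>I\<in>instances. \<exists>ks m. run A (orc I) I ks m)"

definition uses_advice_bits :: "algorithm \<Rightarrow> oracle_fun \<Rightarrow> (nat \<Rightarrow> nat) \<Rightarrow> bool" where
  "uses_advice_bits A orc f \<longleftrightarrow>
    (\<forall>I\<in>instances. bits_read A (orc I) I \<le> f (length I))"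

text \<open>The quotient is taken in \<^typ>\<open>ennreal\<close>, where a positive number divided by 0 is
  \<open>\<infinity>\<close>.  Instances whose optimum is 0 impose no condition, as there 0 / 0 = 0.\<close>

definition competitive_ratio :: "algorithm \<Rightarrow> oracle_fun \<Rightarrow> ennreal" where
  "competitive_ratio A orc =
    (SUP I\<in>instances. ennreal (opt I) / ennreal (gain A (orc I) I))"

end

theory Submission
  imports Defs
begin

text \<open>For \<open>\<epsilon> \<ge> 1\<close>, filling the knapsack with copies of the first item of positive size needs no
  advice and packs at least \<open>1/2\<close>.  For \<open>\<epsilon> < 1\<close> put \<open>\<delta> = \<epsilon>/8\<close>.  An optimal packing contains at most
  \<open>1/\<delta>\<close> copies of items of size at least \<open>\<delta>\<close>, and the advice names the item of each of them.  All
  smaller items of the optimal packing are replaced by copies of a single one of them; the advice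
  names it together with the total size of the small items rounded down to a multiple of \<open>\<delta>\<close>.
  At most \<open>2\<delta>\<close> is lost, whereas the optimum is at least \<open>1/2\<close>.  The number of items is unknown to
  the algorithm, so the length of the numbers on the tape is written first, in unary.\<close>

section \<open>Packings\<close>

lemma packed_snoc:
  assumes "length ks = length I"
  shows "packed (I @ [x]) (ks @ [k]) = packed I ks + real k * x"
proof -
  have "(\<Sum>i<length I. real ((ks @ [k]) ! i) * (I @ [x]) ! i) = packed I ks"
    unfolding packed_def using assms by (intro sum.cong) (auto simp: nth_append)
  then show ?thesis
    using assms by (simp add: packed_def nth_append)
qed

lemma instances_nth:
  assumes "I \<in> instances" "i < length I"
  shows "0 \<le> I ! i" "I ! i \<le> 1"
  using assms nth_mem[OF assms(2)] by (auto simp: instances_def subset_iff)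

lemma instances_snoc: "I @ [x] \<in> instances \<longleftrightarrow> I \<in> instances \<and> 0 \<le> x \<and> x \<le> 1"
  by (auto simp: instances_def)

lemma packed_nonneg: "I \<in> instances \<Longrightarrow> 0 \<le> packed I ks"
  unfolding packed_def by (intro sum_nonneg mult_nonneg_nonneg) (auto simp: instances_nth)

lemma opt_attained:
  assumes "I \<in> instances"
  obtains ks where "ks \<in> packings I" "opt I = packed I ks"
proof -
  have "opt I \<in> packed I ` packings I"
    unfolding opt_def using finite_packed_packings[OF assms] packings_nonempty[of I]
    by (intro Max_in) auto
  then show ?thesis using that by auto
qed

lemma packed_le_opt: "I \<in> instances \<Longrightarrow> ks \<in> packings I \<Longrightarrow> packed I ks \<le> opt I"
  unfolding opt_def using finite_packed_packings by (intro Max_ge) auto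

lemma opt_nonneg: "I \<in> instances \<Longrightarrow> 0 \<le> opt I"
  using packed_le_opt[OF _ packings_nonempty] packed_nonneg order_trans by blast

lemma opt_le_1: "I \<in> instances \<Longrightarrow> opt I \<le> 1"
  by (metis (no_types, lifting) mem_Collect_eq opt_attained packings_def)

lemma fill_le:
  fixes v s :: real
  assumes "0 \<le> v" "0 \<le> s"
  shows "real (nat \<lfloor>v / s\<rfloor>) * s \<le> v"
proof (cases "s = 0")
  case False
  have "real (nat \<lfloor>v / s\<rfloor>) \<le> v / s" using assms by simp
  moreover have "0 < s" using assms False by simp
  ultimately show ?thesis using pos_le_divide_eq by blast
qed (use assms in simp)

lemma fill_gt:
  fixes v s :: real
  assumes "0 < s"
  shows "v - s < real (nat \<lfloor>v / s\<rfloor>) * s"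
proof -
  have "v / s < real (nat \<lfloor>v / s\<rfloor>) + 1" by linarith
  then show ?thesis using assms by (simp add: pos_divide_less_eq algebra_simps)
qed

text \<open>At least one copy fits, so the filled size is at least \<open>s\<close>; it also exceeds
  \<open>1 - s\<close>, and one of the two is at least 1/2.\<close>

lemma fill_ge_half:
  fixes s :: real
  assumes "0 < s" "s \<le> 1"
  shows "1 / 2 \<le> real (nat \<lfloor>1 / s\<rfloor>) * s"
proof -
  have "1 \<le> nat \<lfloor>1 / s\<rfloor>" using assms by (simp add: le_nat_iff)
  then have "1 * s \<le> real (nat \<lfloor>1 / s\<rfloor>) * s"
    using assms by (intro mult_right_mono) auto
  then show ?thesis using fill_gt[OF assms(1), of 1] by linarith
qed

lemma opt_ge_half:
  assumes I: "I \<in> instances" and i: "i < length I" "0 < I ! i"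
  shows "1 / 2 \<le> opt I"
proof -
  define ks where "ks = (replicate (length I) 0)[i := nat \<lfloor>1 / I ! i\<rfloor>]"
  have "packed I ks = (\<Sum>j<length I. if j = i then real (nat \<lfloor>1 / I ! i\<rfloor>) * I ! i else 0)"
    unfolding packed_def ks_def by (intro sum.cong) auto
  also have "\<dots> = real (nat \<lfloor>1 / I ! i\<rfloor>) * I ! i"
    using i by simp
  finally have eq: "packed I ks = real (nat \<lfloor>1 / I ! i\<rfloor>) * I ! i" .
  have "ks \<in> packings I"
    using fill_le[of 1 "I ! i"] i by (simp add: packings_def eq) (simp add: ks_def)
  then have "packed I ks \<le> opt I" by (rule packed_le_opt[OF I])
  moreover have "1 / 2 \<le> packed I ks"
    unfolding eq using fill_ge_half i instances_nth[OF I i(1)] by blast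
  ultimately show ?thesis by linarith
qed

lemma opt_eq_0:
  assumes "set I \<subseteq> {0}"
  shows "opt I = 0"
proof -
  have I: "I \<in> instances" using assms by (auto simp: instances_def)
  obtain ks where "opt I = packed I ks" using opt_attained[OF I] by blast
  also have "\<dots> = 0"
    unfolding packed_def using assms nth_mem[of _ I] by (intro sum.neutral) fastforce
  finally show ?thesis .
qed

section \<open>Algorithms that read all advice before the first item\<close>

text \<open>Each decision sees only the prefix ending in the current item, so the packing is online
  by construction.\<close>

definition responses :: "(real list \<Rightarrow> nat) \<Rightarrow> real list \<Rightarrow> nat list" where
  "responses h I = map (\<lambda>i. h (take (Suc i) I)) [0..<length I]"

lemma responses_Nil [simp]: "responses h [] = []"
  by (simp add: responses_def)

lemma responses_snoc [simp]: "responses h (I @ [x]) = responses h I @ [h (I @ [x])]"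
  by (simp add: responses_def)

lemma length_responses [simp]: "length (responses h I) = length I"
  by (simp add: responses_def)

text \<open>Overflow is avoided by refusing the current item as soon as the wishes \<open>h\<close> up to now, rather
  than the copies actually packed, exceed the capacity; this needs no recursion.\<close>

definition capped :: "(real list \<Rightarrow> nat) \<Rightarrow> real list \<Rightarrow> nat" where
  "capped h I = (if packed I (responses h I) \<le> 1 then h I else 0)"

text \<open>The comparison with the wishes makes the induction go through: a wish is granted only if
  all wishes so far fit, and the copies packed earlier take no more room than the earlier
  wishes.\<close>

lemma packed_capped_bounds:
  assumes "I \<in> instances"
  shows "packed I (responses (capped h) I) \<le> 1 \<and>
    packed I (responses (capped h) I) \<le> packed I (responses h I)"
  using assms
proof (induction I rule: rev_induct)
  case Nil
  then show ?case by (simp add: packed_def)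
next
  case (snoc x I)
  then have "0 \<le> real (h (I @ [x])) * x" by (simp add: instances_snoc)
  with snoc show ?case
    by (auto simp: packed_snoc instances_snoc capped_def)
qed

text \<open>Sizes are nonnegative, so if all wishes fit, then those for each prefix fit and the cap
  never takes effect.\<close>

lemma responses_capped:
  assumes "I \<in> instances" "packed I (responses h I) \<le> 1"
  shows "responses (capped h) I = responses h I"
  using assms
proof (induction I rule: rev_induct)
  case Nil
  then show ?case by simp
next
  case (snoc x I)
  then have "0 \<le> real (h (I @ [x])) * x" by (simp add: instances_snoc)
  moreover have "packed I (responses h I) + real (h (I @ [x])) * x \<le> 1"
    using snoc.prems by (simp add: packed_snoc)
  ultimately have "packed I (responses h I) \<le> 1" by linarith
  with snoc show ?case
    by (simp add: instances_snoc capped_def[of _ "I @ [x]"])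
qed

definition scheme :: "(bool list \<Rightarrow> 'd option) \<Rightarrow> ('d \<Rightarrow> real list \<Rightarrow> nat) \<Rightarrow> algorithm" where
  "scheme dec want I bs = map_option (\<lambda>d. capped (want d) I) (dec bs)"

lemma run_schemeD:
  assumes "run (scheme dec want) \<phi> I ks m" "I \<noteq> []"
  shows "\<exists>d. dec (bits \<phi> m) = Some d \<and> ks = responses (capped (want d)) I"
  using assms
proof (induction rule: run.induct)
  case empty
  then show ?case by simp
next
  case (item I ks m m' x k)
  obtain d where d: "dec (bits \<phi> m') = Some d" "k = capped (want d) (I @ [x])"
    using item.hyps by (auto simp: scheme_def)
  show ?case
  proof (cases "I = []")
    case True
    then have "ks = []" using run_length[OF item.hyps(1)] by simp
    then show ?thesis using d True responses_snoc[of _ "[]"] by simp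
  next
    case False
    then obtain d' where d': "dec (bits \<phi> m) = Some d'" "ks = responses (capped (want d')) I"
      using item.IH by blast
    \<comment> \<open>For \<open>m < m'\<close> the run would require
      \<open>dec (bits \<phi> m) = None\<close>, but \<open>dec\<close> has already succeeded
      there.\<close>
    have "m' = m"
      using item.hyps d' by (metis le_neq_implies_less order_refl option.distinct(1)
          option.map_disc_iff scheme_def)
    then show ?thesis using d d' by simp
  qed
qed

lemma run_schemeI:
  assumes dec: "dec (bits \<phi> m) = Some d" and first: "\<forall>j<m. dec (bits \<phi> j) = None"
    and "I \<noteq> []"
  shows "run (scheme dec want) \<phi> I (responses (capped (want d)) I) m"
  using \<open>I \<noteq> []\<close>
proof (induction I rule: rev_induct)
  case Nil
  then show ?case by simp
next
  case (snoc x I)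
  \<comment> \<open>No bit is read before the first item; after it, all \<open>m\<close> bits have
    been read.\<close>
  define m\<^sub>0 where "m\<^sub>0 = (if I = [] then 0 else m)"
  have "run (scheme dec want) \<phi> I (responses (capped (want d)) I) m\<^sub>0"
    using snoc.IH by (auto simp: m\<^sub>0_def intro: run.empty)
  moreover have "m\<^sub>0 \<le> m" by (simp add: m\<^sub>0_def)
  moreover have "\<forall>j. m\<^sub>0 \<le> j \<and> j < m \<longrightarrow> scheme dec want (I @ [x]) (bits \<phi> j) = None"
    using first by (simp add: scheme_def)
  moreover have "scheme dec want (I @ [x]) (bits \<phi> m) = Some (capped (want d) (I @ [x]))"
    by (simp add: scheme_def dec)
  ultimately show ?case
    using run.item by fastforce
qed

text \<open>The product form forces \<open>opt I = 0\<close> when the gain is 0, so the quotient in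
  \<open>ennreal\<close> is then 0.\<close>

lemma competitive_ratio_le:
  assumes "0 < c" and le: "\<And>I. I \<in> instances \<Longrightarrow> opt I \<le> c * gain A (orc I) I"
  shows "competitive_ratio A orc \<le> ennreal c"
  unfolding competitive_ratio_def
proof (rule SUP_least)
  fix I assume I: "I \<in> instances"
  let ?g = "gain A (orc I) I"
  have g: "0 \<le> ?g" "opt I \<le> c * ?g"
    using packed_nonneg[OF I] le[OF I] by (simp_all add: gain_def)
  show "ennreal (opt I) / ennreal ?g \<le> ennreal c"
  proof (cases "?g = 0")
    case True
    then have "opt I = 0" using g opt_nonneg[OF I] by simp
    then show ?thesis by simp
  next
    case False
    then have "0 < ?g" using g by simp
    then have "opt I / ?g \<le> c" using g by (simp add: pos_divide_le_eq)
    then show ?thesis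
      using \<open>0 < ?g\<close> opt_nonneg[OF I] by (simp add: divide_ennreal ennreal_leI)
  qed
qed

text \<open>The cap secures every tape and leaves fitting wishes unchanged. It remains to supply,
  instance by instance, good wishes and a tape that encodes them; the oracle collects these tapes by
  choice.\<close>

lemma online_scheme:
  fixes dec :: "bool list \<Rightarrow> 'd option"
  assumes "0 < c"
    and advice: "\<And>I. I \<in> instances \<Longrightarrow> I \<noteq> [] \<Longrightarrow> \<exists>\<phi> d. dec (bits \<phi> (f (length I))) = Some d \<and>
      (\<forall>j<f (length I). dec (bits \<phi> j) = None) \<and>
      packed I (responses (want d) I) \<le> 1 \<and> opt I \<le> c * packed I (responses (want d) I)"
  shows "\<exists>A orc. online_algorithm_with_advice A orc \<and> uses_advice_bits A orc f \<and>
    competitive_ratio A orc \<le> ennreal c"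
proof -
  define A where "A = scheme dec want"
  have "\<exists>\<phi> ks m. run A \<phi> I ks m \<and> m \<le> f (length I) \<and> opt I \<le> c * packed I ks"
    if I: "I \<in> instances" for I
  proof (cases "I = []")
    case True
    then show ?thesis
      using opt_eq_0[of "[]"] run.empty[of A] by (force simp: packed_def)
  next
    case False
    then obtain \<phi> d where d: "dec (bits \<phi> (f (length I))) = Some d"
      "\<forall>j<f (length I). dec (bits \<phi> j) = None"
      "packed I (responses (want d) I) \<le> 1" "opt I \<le> c * packed I (responses (want d) I)"
      using advice[OF I] by blast
    show ?thesis
      using run_schemeI[OF d(1,2) False] d(4) responses_capped[OF I d(3)]
      unfolding A_def by (metis order_refl)
  qed
  then obtain orc where orc: "\<And>I. I \<in> instances \<Longrightarrow>
      \<exists>ks m. run A (orc I) I ks m \<and> m \<le> f (length I) \<and> opt I \<le> c * packed I ks"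
    by metis
  have "packed I ks \<le> 1" if "I \<in> instances" "run A \<phi> I ks m" for I \<phi> ks m
  proof (cases "I = []")
    case True
    then show ?thesis by (simp add: packed_def)
  next
    case False
    then show ?thesis
      using run_schemeD[of dec want] that packed_capped_bounds unfolding A_def by metis
  qed
  then have "online_algorithm_with_advice A orc"
    unfolding online_algorithm_with_advice_def using orc by blast
  moreover have "uses_advice_bits A orc f"
    unfolding uses_advice_bits_def using orc run_packing_bits_read(2) by metis
  moreover have "opt I \<le> c * gain A (orc I) I" if "I \<in> instances" for I
    using orc[OF that] run_packing_bits_read(1) by (metis gain_def)
  then have "competitive_ratio A orc \<le> ennreal c"
    by (rule competitive_ratio_le[OF \<open>0 < c\<close>])
  ultimately show ?thesis by blast
qed

section \<open>No advice\<close>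

text \<open>If the current item has size 0, then \<open>1 / last I = 0\<close>.\<close>

definition fill_first :: "real list \<Rightarrow> nat" where
  "fill_first I = (if set (butlast I) \<subseteq> {0} then nat \<lfloor>1 / last I\<rfloor> else 0)"

text \<open>The three claims need a joint induction: at the first positive item the packed size is
  still 0, so filling cannot overflow and yields at least 1/2; later items are refused.\<close>

lemma packed_fill_first:
  assumes "I \<in> instances"
  shows "packed I (responses fill_first I) \<le> 1 \<and>
    (\<not> set I \<subseteq> {0} \<longrightarrow> 1 / 2 \<le> packed I (responses fill_first I)) \<and>
    (set I \<subseteq> {0} \<longrightarrow> packed I (responses fill_first I) = 0)"
  using assms
proof (induction I rule: rev_induct)
  case Nil
  then show ?case by (simp add: packed_def)
next
  case (snoc x I)
  then show ?case
    using fill_le[of 1 x] fill_ge_half[of x]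
    by (auto simp: packed_snoc instances_snoc fill_first_def)
qed

lemma online_without_advice:
  assumes "2 \<le> c"
  shows "\<exists>A orc. online_algorithm_with_advice A orc \<and> uses_advice_bits A orc (\<lambda>_. 0) \<and>
    competitive_ratio A orc \<le> ennreal c"
proof (rule online_scheme[where dec = "\<lambda>_. Some ()" and want = "\<lambda>_. fill_first"])
  fix I assume I: "I \<in> instances"
  let ?p = "packed I (responses fill_first I)"
  have "opt I \<le> c * ?p"
  proof (cases "set I \<subseteq> {0}")
    case True
    then show ?thesis using packed_fill_first[OF I] by (simp add: opt_eq_0)
  next
    case False
    then have "2 * (1 / 2) \<le> c * ?p"
      using packed_fill_first[OF I] assms by (intro mult_mono) auto
    then show ?thesis using opt_le_1[OF I] by linarith
  qed
  then show "\<exists>\<phi> d. Some () = Some d \<and> (\<forall>j<0::nat. Some () = None) \<and> ?p \<le> 1 \<and> opt I \<le> c * ?p"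
    using packed_fill_first[OF I] by auto
qed (use assms in simp)

section \<open>Self-delimiting advice\<close>

text \<open>A codeword consists of \<open>w\<close> ones, a zero and \<open>c * w\<close> payload
  bits. The block count \<open>c\<close> is built into the algorithm, whereas \<open>w\<close>
  depends on the instance and is recovered from the tape.\<close>

definition decode :: "nat \<Rightarrow> (nat \<Rightarrow> bool list \<Rightarrow> 'd) \<Rightarrow> bool list \<Rightarrow> 'd option" where
  "decode c g bs = (let w = length (takeWhile id bs) in
    if length bs = w + 1 + c * w then Some (g w (drop (Suc w) bs)) else None)"

lemma decode_advice:
  assumes ps: "length ps = c * w"
  obtains \<phi> where "decode c g (bits \<phi> (w + 1 + c * w)) = Some (g w ps)"
    and "\<forall>j<w + 1 + c * w. decode c g (bits \<phi> j) = None"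
proof -
  define \<phi> where "\<phi> i = (i < w \<or> i \<noteq> w \<and> ps ! (i - Suc w))" for i
  have short: "bits \<phi> m = replicate m True" if "m \<le> w" for m
    using that by (intro nth_equalityI) (auto simp: bits_def \<phi>_def)
  have long: "bits \<phi> m = replicate w True @ False # map (\<lambda>i. ps ! i) [0..<m - Suc w]"
    if "w < m" for m
    using that by (intro nth_equalityI) (auto simp: bits_def \<phi>_def nth_append nth_Cons')
  have takeWhile: "takeWhile id (replicate w True @ False # bs) = replicate w True" for bs
    by (induction w) auto
  have none: "decode c g (bits \<phi> j) = None" if "j < w + 1 + c * w" for j
  proof (cases "j \<le> w")
    case True
    \<comment> \<open>A prefix of \<open>j\<close> ones is itself taken for width \<open>j\<close>;
      the length test fails because \<open>j < j + 1 + c * j\<close>.\<close>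
    then show ?thesis by (simp add: decode_def short Let_def)
  next
    case False
    then show ?thesis using that by (simp add: decode_def long takeWhile Let_def)
  qed
  have "map (\<lambda>i. ps ! i) [0..<c * w] = ps"
    using map_nth[of ps] ps by simp
  then have "decode c g (bits \<phi> (w + 1 + c * w)) = Some (g w ps)"
    using ps by (simp add: decode_def long takeWhile Let_def)
  then show ?thesis using that none by blast
qed

text \<open>Both sets have \<open>2 ^ (c * w)\<close> elements, so a bijection exists. An explicit
  binary representation can be avoided because an algorithm may be any function.\<close>

lemma ex_block_code:
  "\<exists>g. \<forall>w. {xs. set xs \<subseteq> {..<2 ^ w :: nat} \<and> length xs = c} \<subseteq>
    g w ` {ps :: bool list. length ps = c * w}" for c :: nat
proof -
  have "\<exists>h. {xs. set xs \<subseteq> {..<2 ^ w :: nat} \<and> length xs = c} \<subseteq>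
      h ` {ps :: bool list. length ps = c * w}" for w
  proof -
    let ?X = "{xs. set xs \<subseteq> {..<2 ^ w :: nat} \<and> length xs = c}"
    let ?P = "{ps :: bool list. length ps = c * w}"
    have "card ?P = 2 ^ (c * w)" "finite ?P"
      using card_lists_length_eq[of "UNIV :: bool set" "c * w"]
        finite_lists_length_eq[of "UNIV :: bool set" "c * w"] by simp_all
    moreover have "card ?X = (2 ^ w) ^ c" "finite ?X"
      using card_lists_length_eq[of "{..<2 ^ w :: nat}" c]
        finite_lists_length_eq[of "{..<2 ^ w :: nat}" c] by simp_all
    ultimately have "\<exists>h. bij_betw h ?P ?X"
      by (intro finite_same_card_bij) (simp_all add: power_mult[symmetric] mult.commute)
    then show ?thesis by (auto simp: bij_betw_def)
  qed
  then show ?thesis by metis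
qed

section \<open>Advice for ratio close to 1\<close>

text \<open>Positions are counted from 1, as this makes \<open>length I\<close> the position of the current item and
  leaves 0 for padding.\<close>

definition follow :: "real \<Rightarrow> nat list \<Rightarrow> real list \<Rightarrow> nat" where
  "follow \<delta> ds I = count_list (drop 2 ds) (length I) +
    (if length I = ds ! 1 then nat \<lfloor>real (ds ! 0) * \<delta> / last I\<rfloor> else 0)"

text \<open>In \<open>K # j # cs\<close>, \<open>K * \<delta>\<close> is the volume reserved for
  small items, \<open>j\<close> the position of the item that fills it, and \<open>cs\<close> lists
  the positions of the large copies with repetition. Position 0 matches no item:
  \<open>j = 0\<close> means no filling, and zeros in \<open>cs\<close> are padding.\<close>

lemma packed_follow:
  "packed I (responses (follow \<delta> (K # j # cs)) I) =
    (\<Sum>i<length I. real (count_list cs (Suc i)) * I ! i) +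
    (if 0 < j \<and> j \<le> length I
     then real (nat \<lfloor>real K * \<delta> / I ! (j - 1)\<rfloor>) * I ! (j - 1) else 0)"
proof -
  have "responses (follow \<delta> (K # j # cs)) I ! i = count_list cs (Suc i) +
      (if Suc i = j then nat \<lfloor>real K * \<delta> / I ! i\<rfloor> else 0)" if "i < length I" for i
  proof -
    have "length (take (Suc i) I) = Suc i" "last (take (Suc i) I) = I ! i"
      using that by (simp_all add: take_Suc_conv_app_nth)
    then show ?thesis using that by (auto simp: responses_def follow_def)
  qed
  then have "packed I (responses (follow \<delta> (K # j # cs)) I) =
      (\<Sum>i<length I. real (count_list cs (Suc i)) * I ! i +
        (if Suc i = j then real (nat \<lfloor>real K * \<delta> / I ! i\<rfloor>) * I ! i else 0))"
    unfolding packed_def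
    by (intro sum.cong) (auto simp: algebra_simps)
  moreover have "(\<Sum>i<length I. if Suc i = j then real (nat \<lfloor>real K * \<delta> / I ! i\<rfloor>) * I ! i else 0) =
      (if 0 < j \<and> j \<le> length I
       then real (nat \<lfloor>real K * \<delta> / I ! (j - 1)\<rfloor>) * I ! (j - 1) else 0)"
    by (cases j) (auto simp: Suc_le_eq)
  ultimately show ?thesis by (simp only: sum.distrib)
qed

text \<open>The decoder expects a fixed number of entries, so the list of positions is padded with
  zeros to length \<open>M\<close>; no \<open>Suc i\<close> counts them.\<close>

lemma ex_count_list:
  assumes "(\<Sum>i<n. k i) \<le> M"
  shows "\<exists>cs. length cs = M \<and> set cs \<subseteq> {..n} \<and> (\<forall>i<n. count_list cs (Suc i) = k i)"
  using assms
proof (induction n arbitrary: M)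
  case 0
  then show ?case by (intro exI[of _ "replicate M 0"]) auto
next
  case (Suc n)
  \<comment> \<open>This leaves \<open>k n\<close> entries for position
    \<open>Suc n\<close>.\<close>
  then have "(\<Sum>i<n. k i) \<le> M - k n" by simp
  from Suc.IH[OF this] obtain cs where cs: "length cs = M - k n" "set cs \<subseteq> {..n}"
    "\<forall>i<n. count_list cs (Suc i) = k i" by blast
  have count: "count_list (replicate m y) z = (if y = z then m else 0)" for m and y z :: nat
    by (induction m) auto
  have "Suc n \<notin> set cs" using cs(2) by auto
  then have "count_list (cs @ replicate (k n) (Suc n)) (Suc i) = k i" if "i < Suc n" for i
    using that cs(3) by (auto simp: count less_Suc_eq)
  moreover have "length (cs @ replicate (k n) (Suc n)) = M"
    using cs(1) Suc.prems by simp
  moreover have "set (cs @ replicate (k n) (Suc n)) \<subseteq> {..Suc n}"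
    using cs(2) by (auto split: if_splits)
  ultimately show ?case by blast
qed

lemma ex_follow:
  assumes I: "I \<in> instances" and \<delta>: "0 < \<delta>"
  shows "\<exists>K j cs. real K \<le> 1 / \<delta> \<and> j \<le> length I \<and>
    length cs = nat \<lfloor>1 / \<delta>\<rfloor> \<and> set cs \<subseteq> {..length I} \<and>
    packed I (responses (follow \<delta> (K # j # cs)) I) \<le> 1 \<and>
    opt I - 2 * \<delta> \<le> packed I (responses (follow \<delta> (K # j # cs)) I)"
proof -
  obtain ks where ks: "ks \<in> packings I" "opt I = packed I ks"
    using opt_attained[OF I] by blast
  define n where "n = length I"
  define k where "k i = (if I ! i < \<delta> then 0 else ks ! i)" for i
  define large where "large = (\<Sum>i<n. real (k i) * I ! i)"
  define small where "small = (\<Sum>i<n. if I ! i < \<delta> then real (ks ! i) * I ! i else 0)"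
  have opt: "opt I = large + small"
    unfolding ks(2) packed_def large_def small_def n_def k_def sum.distrib[symmetric]
    by (intro sum.cong) auto
  have nonneg: "0 \<le> I ! i" if "i < n" for i
    using instances_nth[OF I] that n_def by simp
  have "0 \<le> large" "0 \<le> small"
    unfolding large_def small_def using nonneg by (auto intro!: sum_nonneg)
  then have le1: "0 \<le> large" "large \<le> 1" "0 \<le> small" "small \<le> 1"
    using opt opt_le_1[OF I] by linarith+
  \<comment> \<open>Every copy counted by \<open>k\<close> has size at least \<delta>; as their
    total size is at most 1, this bounds their number.\<close>
  have "real (\<Sum>i<n. k i) * \<delta> \<le> large"
    unfolding large_def of_nat_sum sum_distrib_right
    by (intro sum_mono) (auto simp: k_def intro: mult_left_mono)
  then have "real (\<Sum>i<n. k i) \<le> 1 / \<delta>"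
    using le1 \<delta> by (simp add: pos_le_divide_eq)
  then have "(\<Sum>i<n. k i) \<le> nat \<lfloor>1 / \<delta>\<rfloor>"
    by (simp add: le_nat_floor)
  from ex_count_list[OF this] obtain cs where cs: "length cs = nat \<lfloor>1 / \<delta>\<rfloor>" "set cs \<subseteq> {..n}"
    "\<forall>i<n. count_list cs (Suc i) = k i" by blast
  have packed: "packed I (responses (follow \<delta> (K # j # cs)) I) = large +
    (if 0 < j \<and> j \<le> n then real (nat \<lfloor>real K * \<delta> / I ! (j - 1)\<rfloor>) * I ! (j - 1) else 0)" for K j
    unfolding packed_follow large_def n_def[symmetric] using cs(3) by simp
  \<comment> \<open>Rounding the small volume down to a multiple of \<delta> loses less than
    \<delta>.\<close>
  define K where "K = nat \<lfloor>small / \<delta>\<rfloor>"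
  have K: "real K * \<delta> \<le> small" "small - \<delta> < real K * \<delta>"
    unfolding K_def using fill_le[of small \<delta>] fill_gt[of \<delta> small] \<delta> le1(3) by linarith+
  then have "real K * \<delta> \<le> 1" using le1 by linarith
  then have K1: "real K \<le> 1 / \<delta>" using \<delta> by (simp add: pos_le_divide_eq)
  show ?thesis
  \<comment> \<open>Any positive item below \<delta> can serve as the filler, whether or not the
    optimal packing uses it; filling loses less than its size, hence less than \<delta>
    again.\<close>
  proof (cases "\<exists>i<n. 0 < I ! i \<and> I ! i < \<delta>")
    case True
    then obtain i where i: "i < n" "0 < I ! i" "I ! i < \<delta>" by blast
    let ?p = "real (nat \<lfloor>real K * \<delta> / I ! i\<rfloor>) * I ! i"
    have "?p \<le> real K * \<delta>" "real K * \<delta> - I ! i < ?p"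
      using fill_le[of "real K * \<delta>" "I ! i"] fill_gt[OF i(2), of "real K * \<delta>"] \<delta> i(2) by auto
    then have "large + ?p \<le> 1" "opt I - 2 * \<delta> \<le> large + ?p"
      using K i(3) opt opt_le_1[OF I] by linarith+
    moreover have "packed I (responses (follow \<delta> (K # Suc i # cs)) I) = large + ?p"
      using packed[of K "Suc i"] i(1) by simp
    ultimately show ?thesis
      using K1 i(1) cs(1,2) n_def by (intro exI[of _ K] exI[of _ "Suc i"] exI[of _ cs]) auto
  next
    case False
    \<comment> \<open>Every small item now has size 0, so nothing is to be replaced and
      \<open>j = 0\<close> suffices.\<close>
    have "(if I ! i < \<delta> then real (ks ! i) * I ! i else 0) = 0" if "i < n" for i
      using False nonneg[OF that] that by force
    then have "small = 0" unfolding small_def by simp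
    then have "packed I (responses (follow \<delta> (K # 0 # cs)) I) = opt I"
      using packed[of K 0] opt by simp
    then show ?thesis
      using K1 cs(1,2) n_def \<delta> opt_le_1[OF I]
      by (intro exI[of _ K] exI[of _ 0] exI[of _ cs]) auto
  qed
qed

text \<open>Here \<epsilon>/4 is the loss 2\<delta> for \<delta> = \<epsilon>/8. The slack splits
  into two nonnegative terms, one by \<open>1 / 2 \<le> v\<close>, the other by \<epsilon> <
  1.\<close>

lemma ratio_bound:
  fixes \<epsilon> :: real
  assumes "0 < \<epsilon>" "\<epsilon> < 1" "1 / 2 \<le> v" "v - \<epsilon> / 4 \<le> p"
  shows "v \<le> (1 + \<epsilon>) * p"
proof -
  have "(1 + \<epsilon>) * (v - \<epsilon> / 4) - v = \<epsilon> * (v - 1 / 2) + \<epsilon> * (1 - \<epsilon>) / 4"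
    by (simp add: field_simps)
  also have "\<dots> \<ge> 0"
    using assms by (intro add_nonneg_nonneg mult_nonneg_nonneg divide_nonneg_nonneg) auto
  finally have "v \<le> (1 + \<epsilon>) * (v - \<epsilon> / 4)" by simp
  also have "\<dots> \<le> (1 + \<epsilon>) * p" using assms by (intro mult_left_mono) auto
  finally show ?thesis .
qed

text \<open>A common width for all entries: positions are at most \<open>n\<close> and
  \<open>K\<close> is at most 8/\<epsilon>, and for 0 < \<epsilon> < 1 and \<open>0 < n\<close> both
  bounds lie strictly below 16n/\<epsilon>.\<close>

definition width :: "real \<Rightarrow> nat \<Rightarrow> nat" where
  "width \<epsilon> n = nat \<lceil>log 2 (16 * real n / \<epsilon>)\<rceil>"

text \<open>The unary width and its end marker, then the blocks: 1/\<delta> = 8/\<epsilon>, rounded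
  down, for the large copies and two for \<open>K\<close> and \<open>j\<close>.\<close>

definition advice_length :: "real \<Rightarrow> nat \<Rightarrow> nat" where
  "advice_length \<epsilon> n = width \<epsilon> n + 1 + (nat \<lfloor>8 / \<epsilon>\<rfloor> + 2) * width \<epsilon> n"

lemma width_bound:
  assumes "0 < \<epsilon>" "0 < n"
  shows "16 * real n / \<epsilon> \<le> 2 ^ width \<epsilon> n"
proof -
  have "log 2 (16 * real n / \<epsilon>) \<le> real (width \<epsilon> n)"
    unfolding width_def by linarith
  then have "16 * real n / \<epsilon> \<le> 2 powr real (width \<epsilon> n)"
    using assms by (simp add: log_le_iff)
  then show ?thesis by (simp add: powr_realpow)
qed

lemma online_with_advice:
  assumes \<epsilon>: "0 < \<epsilon>" "\<epsilon> < 1"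
  shows "\<exists>A orc. online_algorithm_with_advice A orc \<and>
    uses_advice_bits A orc (advice_length \<epsilon>) \<and> competitive_ratio A orc \<le> ennreal (1 + \<epsilon>)"
proof -
  define c where "c = nat \<lfloor>8 / \<epsilon>\<rfloor> + 2"
  obtain g where g: "\<And>w. {xs. set xs \<subseteq> {..<2 ^ w :: nat} \<and> length xs = c} \<subseteq>
    g w ` {ps :: bool list. length ps = c * w}" using ex_block_code by blast
  show ?thesis
  proof (rule online_scheme[where dec = "decode c g" and want = "follow (\<epsilon> / 8)"])
    fix I assume I: "I \<in> instances" "I \<noteq> []"
    define n where "n = length I"
    define w where "w = width \<epsilon> n"
    have n: "0 < n" using I n_def by simp
    obtain K j cs where d: "real K \<le> 8 / \<epsilon>" "j \<le> n" "length cs = nat \<lfloor>8 / \<epsilon>\<rfloor>" "set cs \<subseteq> {..n}"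
      and p: "packed I (responses (follow (\<epsilon> / 8) (K # j # cs)) I) \<le> 1"
        "opt I - \<epsilon> / 4 \<le> packed I (responses (follow (\<epsilon> / 8) (K # j # cs)) I)"
      using ex_follow[OF I(1), of "\<epsilon> / 8"] \<epsilon> n_def by auto
    have "real n * \<epsilon> < 16 * real n" using \<epsilon> n by simp
    then have "real n < 16 * real n / \<epsilon>" using \<epsilon> by (simp add: pos_less_divide_eq)
    then have nw: "n < 2 ^ w"
      using width_bound[OF \<epsilon>(1) n] unfolding w_def
      by (metis less_le_trans of_nat_less_iff of_nat_numeral of_nat_power)
    have "8 / \<epsilon> < 16 * real n / \<epsilon>"
      using \<epsilon> n by (simp add: divide_strict_right_mono)
    then have "real K < 2 ^ w"
      using d(1) width_bound[OF \<epsilon>(1) n] unfolding w_def by linarith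
    then have "K < 2 ^ w"
      by (metis of_nat_less_iff of_nat_numeral of_nat_power)
    then have "K # j # cs \<in> {xs. set xs \<subseteq> {..<2 ^ w} \<and> length xs = c}"
      using d nw by (auto simp: c_def)
    then have "K # j # cs \<in> g w ` {ps. length ps = c * w}"
      using g[of w] by (rule subsetD[rotated])
    then obtain ps where ps: "length ps = c * w" "g w ps = K # j # cs" by auto
    obtain \<phi> where \<phi>: "decode c g (bits \<phi> (w + 1 + c * w)) = Some (K # j # cs)"
      "\<forall>j<w + 1 + c * w. decode c g (bits \<phi> j) = None"
      using decode_advice[OF ps(1), of g] ps(2) by metis
    have "opt I \<le> (1 + \<epsilon>) * packed I (responses (follow (\<epsilon> / 8) (K # j # cs)) I)"
    proof (cases "set I \<subseteq> {0}")
      case True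
      then show ?thesis using packed_nonneg[OF I(1)] \<epsilon> by (simp add: opt_eq_0)
    next
      case False
      then obtain i where "i < length I" "I ! i \<noteq> 0"
        by (metis in_set_conv_nth insertI1 subsetI)
      then have "1 / 2 \<le> opt I"
        using instances_nth(1)[OF I(1)] by (intro opt_ge_half[OF I(1)]) force+
      then show ?thesis using ratio_bound[OF \<epsilon>] p(2) by blast
    qed
    moreover have "advice_length \<epsilon> (length I) = w + 1 + c * w"
      by (simp add: advice_length_def w_def c_def n_def)
    ultimately show "\<exists>\<phi> d. decode c g (bits \<phi> (advice_length \<epsilon> (length I))) = Some d \<and>
        (\<forall>j<advice_length \<epsilon> (length I). decode c g (bits \<phi> j) = None) \<and>
        packed I (responses (follow (\<epsilon> / 8) d) I) \<le> 1 \<and>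
        opt I \<le> (1 + \<epsilon>) * packed I (responses (follow (\<epsilon> / 8) d) I)"
      using \<phi> p(1) by metis
  qed (use \<epsilon> in simp)
qed

lemma advice_length_bound:
  assumes \<epsilon>: "0 < \<epsilon>" "\<epsilon> < 1" and n: "2 \<le> real n / \<epsilon>"
  shows "real (advice_length \<epsilon> n) \<le> 72 * ((1 / \<epsilon>) * log 2 (real n / \<epsilon>))"
proof -
  define L where "L = log 2 (real n / \<epsilon>)"
  have pos: "0 < real n / \<epsilon>" using n by linarith
  have L: "1 \<le> L" unfolding L_def using n pos by (simp add: le_log_iff)
  have "log 2 (16 * real n / \<epsilon>) = log 2 (2 ^ 4 * (real n / \<epsilon>))" by simp
  also have "\<dots> = log 2 (2 ^ 4) + L" unfolding L_def using pos by (subst log_mult) auto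
  also have "log 2 (2 ^ 4 :: real) = 4" using log_pow_cancel[of 2 4] by simp
  \<comment> \<open>The ceiling adds at most 1, so the width is at most \<open>L + 5\<close>, and
    \<open>1 \<le> L\<close>.\<close>
  finally have w: "real (width \<epsilon> n) \<le> 6 * L"
    unfolding width_def using L by linarith
  have "real (advice_length \<epsilon> n) = real (width \<epsilon> n) * (real (nat \<lfloor>8 / \<epsilon>\<rfloor>) + 3) + 1"
    by (simp add: advice_length_def algebra_simps)
  also have "\<dots> \<le> 6 * L * (8 / \<epsilon> + 3) + 6 * L"
    using w L \<epsilon> by (intro add_mono mult_mono) auto
  also have "\<dots> = 6 * L * (8 / \<epsilon> + 4)" by (simp add: algebra_simps)
  \<comment> \<open>By \<epsilon> < 1, the summand 4 is at most 4/\<epsilon>; the final constant is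
    6 * 12 = 72.\<close>
  also have "\<dots> \<le> 6 * L * (12 * (1 / \<epsilon>))"
    using L \<epsilon> by (intro mult_left_mono) (auto simp: field_simps)
  finally show ?thesis by (simp add: L_def)
qed

text \<open>The restriction to n/\<epsilon> at least 2 keeps the logarithm at least 1, so that one
  constant, uniform in \<open>n\<close> and \<epsilon>, can express the O-bound.\<close>

theorem theorem6:
  "\<exists>C>0. \<forall>\<epsilon>::real. \<epsilon> > 0 \<longrightarrow>
    (\<exists>A orc f. online_algorithm_with_advice A orc \<and>
      uses_advice_bits A orc f \<and>
      (\<forall>n. real n / \<epsilon> \<ge> 2 \<longrightarrow> real (f n) \<le> C * ((1 / \<epsilon>) * log 2 (real n / \<epsilon>))) \<and>
      competitive_ratio A orc \<le> ennreal (1 + \<epsilon>))"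
proof (intro exI[of _ 72] conjI allI impI)
  fix \<epsilon> :: real assume "\<epsilon> > 0"
  show "\<exists>A orc f. online_algorithm_with_advice A orc \<and>
      uses_advice_bits A orc f \<and>
      (\<forall>n. real n / \<epsilon> \<ge> 2 \<longrightarrow> real (f n) \<le> 72 * ((1 / \<epsilon>) * log 2 (real n / \<epsilon>))) \<and>
      competitive_ratio A orc \<le> ennreal (1 + \<epsilon>)"
  proof (cases "\<epsilon> < 1")
    case True
    then show ?thesis
      using online_with_advice advice_length_bound \<open>\<epsilon> > 0\<close> by meson
  next
    case False
    \<comment> \<open>Here \<open>f\<close> is constantly 0, and only the sign of the bound
      matters.\<close>
    have "0 \<le> log 2 (real n / \<epsilon>)" if "2 \<le> real n / \<epsilon>" for n
      using that by simp
    then have "\<forall>n. real n / \<epsilon> \<ge> 2 \<longrightarrow> real 0 \<le> 72 * ((1 / \<epsilon>) * log 2 (real n / \<epsilon>))"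
      using \<open>\<epsilon> > 0\<close> by simp
    then show ?thesis
      using online_without_advice[of "1 + \<epsilon>"] False by fastforce
  qed
qed simp

end
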